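(* Let $0\le\mu<\lambda\le1$ and let $G_{\lambda,\mu}(x)=\frac{1}{(1-\lambda x)(1-\mu x)}$. Let $\sqrt{G_{\lambda,\mu}}$ denote the formal power series square root of $G_{\lambda,\mu}$ with constant term $1$. Then for all $t\in\mathbb{N}$, $$\mathsf{space}_{\sqrt{G_{\lambda,\mu}}}(t;2t)\ \ge\ t-4.$$
   Context: Indices start at $0$, $\mathbb{N}=\{0,1,2,\dots\}$. For a sequence $a$ (equivalently its generating function $G=\sum a_kx^k$), $T[a]$ is the lower-triangular Toeplitz matrix with $T_{i,j}=a_{i-j}$ for $i\ge j$ and $0$ otherwise. Streaming model: a streaming algorithm consists of a buffer size function $\beta:\{-1\}\cup\mathbb{N}\to\mathbb{N}$ with $\beta(-1)=1$ and maps $u^{(t)}:\mathbb{R}^{\beta(t-1)}\times\mathbb{R}\to\mathbb{R}^{\beta(t)}$, $m^{(t)}:\mathbb{R}^{\beta(t)}\to\mathbb{R}$. On input $z\in\mathbb{R}^{\mathbb{N}}$, $s^{(-1)}=0\in\mathbb{R}$, $s^{(t)}=u^{(t)}(s^{(t-1)},z_t)$, output at time $t$ is $m^{(t)}(s^{(t)})$. For each $t$ the map $(z_0,\dots,z_t)\mapsto s^{(t)}$ must be continuous (output maps need not be). The algorithm computes $M$ correctly up to time $\tau$ if $m^{(t)}(s^{(t)})=(Mz)_t$ for all $z$ and all $t\le\tau$. $\mathsf{space}_M(t;\tau)$ is the minimum $b$ such that some streaming algorithm computes $M$ correctly up to time $\tau$ with $\max_{t'\le t}\beta(t')\le b$.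 $\mathsf{space}_{G}(t;\tau)$ denotes $\mathsf{space}_{T[a]}(t;\tau)$ where $a$ is the coefficient sequence of $G$. *)

theory Defs
  imports "HOL-Analysis.Analysis" "HOL-Computational_Algebra.Formal_Power_Series"
begin

text \<open>
  A vector in \<open>\<real>\<^sup>n\<close> is a point of \<^term>\<open>Euclidean_space n\<close>, i.e. a function
  \<^typ>\<open>nat \<Rightarrow> real\<close> that vanishes at all indices \<open>\<ge> n\<close>.

  The buffer sizes \<open>\<beta>(-1), \<beta>(0), \<beta>(1), \<dots>\<close> and the states \<open>s(-1), s(0), s(1), \<dots>\<close> are stored
  with their index shifted by one: \<open>bufsize A k\<close> is \<open>\<beta>(k - 1)\<close>, and \<open>stream_state A z k\<close> is
  \<open>s(k - 1)\<close> on input \<open>z\<close>. The maps \<open>updmap A t\<close> and \<open>outmap A t\<close> are not shifted.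
\<close>

record stream_alg =
  bufsize :: "nat \<Rightarrow> nat"
  updmap :: "nat \<Rightarrow> (nat \<Rightarrow> real) \<Rightarrow> real \<Rightarrow> (nat \<Rightarrow> real)"
  outmap :: "nat \<Rightarrow> (nat \<Rightarrow> real) \<Rightarrow> real"

primrec stream_state :: "stream_alg \<Rightarrow> (nat \<Rightarrow> real) \<Rightarrow> nat \<Rightarrow> (nat \<Rightarrow> real)" where
  "stream_state A z 0 = (\<lambda>_. 0)"
| "stream_state A z (Suc t) = updmap A t (stream_state A z t) (z t)"

text \<open>
  The state at time \<open>t\<close> depends on \<open>z 0, \<dots>, z t\<close> only, so the map from
  \<open>(z 0, \<dots>, z t)\<close> to this state is the restriction of the map below to the inputs that vanish
  after time \<open>t\<close>.
\<close>

definition streaming_algorithm :: "stream_alg \<Rightarrow> bool" where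
  "streaming_algorithm A \<longleftrightarrow>
     bufsize A 0 = 1 \<and>
     (\<forall>t. \<forall>s \<in> topspace (Euclidean_space (bufsize A t)). \<forall>x.
        updmap A t s x \<in> topspace (Euclidean_space (bufsize A (Suc t)))) \<and>
     (\<forall>t. continuous_map (Euclidean_space (Suc t)) (Euclidean_space (bufsize A (Suc t)))
        (\<lambda>z. stream_state A z (Suc t)))"

definition mat_apply :: "(nat \<Rightarrow> nat \<Rightarrow> real) \<Rightarrow> (nat \<Rightarrow> real) \<Rightarrow> nat \<Rightarrow> real" where
  "mat_apply M z i = (\<Sum>j. M i j * z j)"

definition computes_up_to :: "stream_alg \<Rightarrow> (nat \<Rightarrow> nat \<Rightarrow> real) \<Rightarrow> nat \<Rightarrow> bool" where
  "computes_up_to A M \<tau> \<longleftrightarrow>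
     (\<forall>z. \<forall>t\<le>\<tau>. outmap A t (stream_state A z (Suc t)) = mat_apply M z t)"

definition stream_space :: "(nat \<Rightarrow> nat \<Rightarrow> real) \<Rightarrow> nat \<Rightarrow> nat \<Rightarrow> nat" where
  "stream_space M t \<tau> =
     (LEAST b. \<exists>A. streaming_algorithm A \<and> computes_up_to A M \<tau> \<and>
        Max (bufsize A ` {..Suc t}) \<le> b)"

definition toeplitz :: "(nat \<Rightarrow> real) \<Rightarrow> nat \<Rightarrow> nat \<Rightarrow> real" where
  "toeplitz a i j = (if j \<le> i then a (i - j) else 0)"

definition fps_space :: "real fps \<Rightarrow> nat \<Rightarrow> nat \<Rightarrow> nat" where
  "fps_space G = stream_space (toeplitz (fps_nth G))"

definition G_fps :: "real \<Rightarrow> real \<Rightarrow> real fps" where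
  "G_fps l m = 1 / ((1 - fps_const l * fps_X) * (1 - fps_const m * fps_X))"

definition fps_sqrt :: "real fps \<Rightarrow> real fps" where
  "fps_sqrt G = fps_radical root 2 G"

lemma fps_sqrt_unique:
  assumes "fps_nth G 0 = 1"
  shows "S = fps_sqrt G \<longleftrightarrow> S ^ 2 = G \<and> fps_nth S 0 = 1"
proof (cases "fps_nth S 0 = 1")
  case True
  then show ?thesis
    using radical_unique[of root 1 G S] assms
    by (simp add: fps_sqrt_def numeral_2_eq_2)
next
  case False
  then show ?thesis
    using assms by (auto simp: fps_sqrt_def)
qed

lemma G_fps_nth_0: "fps_nth (G_fps l m) 0 = 1"
  by (simp add: G_fps_def fps_divide_unit)

text \<open>
  The minimum in the definition of space is attained for lower triangular matrices:
  an algorithm may store its whole input.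
\<close>

lemma stream_space_attained:
  assumes "\<And>i j. i < j \<Longrightarrow> M i j = 0"
  shows "\<exists>A. streaming_algorithm A \<and> computes_up_to A M \<tau> \<and>
           Max (bufsize A ` {..Suc t}) \<le> stream_space M t \<tau>"
proof -
  define A where
    "A = \<lparr> bufsize = (\<lambda>k. max 1 k), updmap = (\<lambda>t s x. s(t := x)), outmap = (\<lambda>t s. mat_apply M s t) \<rparr>"
  have state: "stream_state A z k = (\<lambda>i. if i < k then z i else 0)" for z k
    by (induction k) (auto simp: A_def fun_eq_iff)
  have "streaming_algorithm A"
    unfolding streaming_algorithm_def
  proof (intro conjI allI ballI)
    fix t s x
    assume "s \<in> topspace (Euclidean_space (bufsize A t))"
    then show "updmap A t s x \<in> topspace (Euclidean_space (bufsize A (Suc t)))"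
      by (auto simp: A_def topspace_Euclidean_space)
  next
    fix t
    have "continuous_map (Euclidean_space (Suc t)) euclideanreal (\<lambda>z. z i)" for i
      unfolding Euclidean_space_def
      by (intro continuous_map_from_subtopology continuous_map_product_projection) simp
    then show "continuous_map (Euclidean_space (Suc t)) (Euclidean_space (bufsize A (Suc t)))
        (\<lambda>z. stream_state A z (Suc t))"
      unfolding state
      using continuous_map_componentwise_Euclidean_space[of "Euclidean_space (Suc t)" "Suc t" "\<lambda>z. z"]
      by (simp add: A_def)
  qed (simp add: A_def)
  moreover have "computes_up_to A M \<tau>"
    unfolding computes_up_to_def state
    by (auto simp: A_def mat_apply_def assms intro!: suminf_cong)
  ultimately have "\<exists>b A. streaming_algorithm A \<and> computes_up_to A M \<tau> \<and>
      Max (bufsize A ` {..Suc t}) \<le> b"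
    by blast
  then show ?thesis
    unfolding stream_space_def by (rule LeastI_ex)
qed

end

theory Submission
  imports Defs "HOL-Homology.Invariance_of_Domain" "HOL-Computational_Algebra.Polynomial_FPS"
begin

text \<open>
  The state at time \<open>t\<close> determines the outputs at times \<open>t, \<dots>, 2t\<close> when all later inputs are \<open>0\<close>.
  These outputs are the coefficients \<open>t, \<dots>, 2t\<close> of the product of the input polynomial \<open>q\<close> with
  \<open>S = sqrt G\<close>. If they all vanish, then \<open>q S = p + O(x\<^bsup>2t+1\<^esup>)\<close> with \<open>deg p < t\<close>, and squaring gives
  \<open>q\<^sup>2 = p\<^sup>2 D + O(x\<^bsup>2t+1\<^esup>)\<close> with \<open>D = (1 - \<lambda>x)(1 - \<mu>x)\<close>. Both sides have degree at most \<open>2t\<close>, so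
  \<open>q\<^sup>2 = p\<^sup>2 D\<close>; since \<open>D\<close> has a simple root, \<open>q = 0\<close>. Hence the state at time \<open>t\<close> is a continuous
  injective function on \<open>\<real>\<^bsup>t+1\<^esup>\<close>, and invariance of domain forces a buffer of size at least \<open>t + 1\<close>.
\<close>

text \<open>If \<open>n < m\<close>, invariance of domain would make the image open in the
  \<open>m\<close>-dimensional space, yet coordinate \<open>n\<close> vanishes on it.\<close>

lemma continuous_inj_Euclidean_space_imp_le:
  assumes f: "continuous_map (Euclidean_space m) (Euclidean_space n) f"
    and inj: "inj_on f (topspace (Euclidean_space m))"
  shows "m \<le> n"
proof (rule ccontr)
  assume "\<not> m \<le> n"
  then have nm: "n < m" by simp
  let ?F = "f ` topspace (Euclidean_space m)"
  have sub: "?F \<subseteq> topspace (Euclidean_space n)"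
    using f by (rule continuous_map_image_subset_topspace)
  have "Euclidean_space n = subtopology (Euclidean_space m) (topspace (Euclidean_space n))"
    using nm
    by (metis Euclidean_space_def inf.absorb_iff2 less_imp_le subset_Euclidean_space
        subtopology_subtopology topspace_Euclidean_space)
  then have "continuous_map (Euclidean_space m) (Euclidean_space m) f"
    using f by (metis continuous_map_in_subtopology)
  then have op: "openin (Euclidean_space m) ?F"
    using inj invariance_of_domain_Euclidean_space[of m "topspace (Euclidean_space m)" f]
    by simp
  define y where "y = f (\<lambda>_. 0)"
  have y: "y \<in> ?F"
    by (auto simp: y_def topspace_Euclidean_space)
  then have y0: "y i = 0" if "n \<le> i" for i
    using sub that by (auto simp: topspace_Euclidean_space)
  \<comment> \<open>The line through \<open>y\<close> in the direction of coordinate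
    \<open>n\<close> meets the image only at \<open>e = 0\<close>, so the preimage of an open set
    would be a singleton.\<close>
  define h where "h = (\<lambda>(e::real) i. if i < m then (if i = n then e else y i) else 0)"
  have "continuous_map euclideanreal (Euclidean_space m) h"
    unfolding h_def continuous_map_componentwise_Euclidean_space by auto
  then have "openin euclideanreal {e \<in> topspace euclideanreal. h e \<in> ?F}"
    using op by (rule openin_continuous_map_preimage)
  then have "open {e. h e \<in> ?F}"
    by simp
  moreover have "{e. h e \<in> ?F} = {0}"
  proof -
    have "h 0 = y"
      using y0 nm by (auto simp: h_def fun_eq_iff)
    moreover have "e = 0" if "h e \<in> ?F" for e
    proof -
      have "h e n = 0"
        using that sub by (auto simp: topspace_Euclidean_space)
      then show ?thesis
        using nm by (simp add: h_def)
    qed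
    ultimately show ?thesis
      using y by auto
  qed
  ultimately show False
    by (simp add: not_open_singleton)
qed

text \<open>Compare orders at \<open>a\<close>: for nonzero \<open>q\<close> the left side has even
  order and the right side odd order.\<close>

lemma square_eq_square_times_odd_order:
  fixes p q D :: "'a::idom poly"
  assumes eq: "q ^ 2 = p ^ 2 * D" and odd: "odd (Polynomial.order a D)"
  shows "q = 0"
proof (rule ccontr)
  assume "q \<noteq> 0"
  then have "q * q \<noteq> 0" "p * p * D \<noteq> 0" and eq': "q * q = p * p * D"
    using eq by (auto simp: power2_eq_square)
  then have "2 * Polynomial.order a q = 2 * Polynomial.order a p + Polynomial.order a D"
    by (metis mult_2 mult_eq_0_iff order_mult)
  then show False
    using odd by presburger
qed

lemma fps_inverse_sqrt_window_eq_0: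
  fixes S :: "'a::idom fps" and D q :: "'a poly"
  assumes S: "S ^ 2 * fps_of_poly D = 1"
    and D: "degree D \<le> 2" "odd (Polynomial.order a D)"
    and q: "degree q \<le> t"
    and window: "\<And>n. t \<le> n \<Longrightarrow> n \<le> 2 * t \<Longrightarrow> fps_nth (fps_of_poly q * S) n = 0"
  shows "q = 0"
proof (rule square_eq_square_times_odd_order[OF _ D(2)])
  define F where "F = fps_of_poly q * S"
  define p where "p = truncate_fps t F"
  define R where "R = fps_shift (2 * t + 1) F"
  have F: "F = fps_of_poly p + fps_X ^ (2 * t + 1) * R"
  proof (rule fps_ext)
    fix n
    show "fps_nth F n = fps_nth (fps_of_poly p + fps_X ^ (2 * t + 1) * R) n"
      unfolding fps_add_nth fps_X_power_mult_nth
      using window[of n] by (auto simp: p_def R_def coeff_truncate_fps F_def)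
  qed
  have "fps_of_poly (q ^ 2) = F ^ 2 * fps_of_poly D"
    using S by (simp add: F_def fps_of_poly_power power_mult_distrib mult.assoc)
  \<comment> \<open>Difference of squares: \<open>F ^ 2 - fps_of_poly p ^ 2\<close> has the factor
    \<open>F - fps_of_poly p\<close>, a multiple of \<open>fps_X ^ (2 * t + 1)\<close>.\<close>
  also have "\<dots> = fps_of_poly (p ^ 2 * D) +
      fps_X ^ (2 * t + 1) * (R * (fps_of_poly p + F) * fps_of_poly D)"
    by (simp add: F fps_of_poly_power fps_of_poly_mult power2_eq_square algebra_simps)
  finally have low: "poly.coeff (q ^ 2) n = poly.coeff (p ^ 2 * D) n" if "n < 2 * t + 1" for n
    using that fps_X_power_mult_nth[of "2 * t + 1"]
    by (metis add.right_neutral fps_add_nth fps_of_poly_nth)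
  have "degree (q ^ 2) \<le> 2 * t"
    using q degree_power_le[of q 2] by linarith
  moreover have "degree (p ^ 2 * D) \<le> 2 * t"
  \<comment> \<open>For \<open>t = 0\<close> the truncation \<open>p\<close> is zero; otherwise
    \<open>degree p \<le> t - 1\<close>, and \<open>D\<close> adds at most 2.\<close>
  proof (cases "t = 0")
    case False
    then have "degree p < t"
      by (simp add: p_def degree_truncate_fps)
    then show ?thesis
      using degree_mult_le[of "p ^ 2" D] degree_power_le[of p 2] D(1) by linarith
  qed (simp add: p_def)
  ultimately show "q ^ 2 = p ^ 2 * D"
    using low by (intro poly_eqI) (metis coeff_eq_0 le_less_trans less_Suc_eq_le not_le Suc_eq_plus1)
qed

lemma mat_apply_toeplitz: "mat_apply (toeplitz (fps_nth S)) z n = fps_nth (Abs_fps z * S) n"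
proof -
  have "mat_apply (toeplitz (fps_nth S)) z n = (\<Sum>j\<le>n. toeplitz (fps_nth S) n j * z j)"
    unfolding mat_apply_def by (rule suminf_finite) (auto simp: toeplitz_def)
  then show ?thesis
    by (simp add: fps_mult_nth toeplitz_def atLeast0AtMost mult.commute[of "fps_nth S _"])
qed

lemma stream_state_eq_later:
  assumes "stream_state A z k = stream_state A z' k" "\<And>i. k \<le> i \<Longrightarrow> z i = z' i" "k \<le> n"
  shows "stream_state A z n = stream_state A z' n"
  using assms(3) by (induction n rule: dec_induct) (use assms in auto)

text \<open>Two inputs that end by time \<open>t\<close> and reach the same state have equal outputs
  from \<open>t\<close> to \<open>\<tau>\<close>. By linearity their difference satisfies
  \<open>window\<close>, so the state map is injective.\<close>

lemma toeplitz_space_lower_bound: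
  assumes window: "\<And>q. degree q \<le> t \<Longrightarrow>
      (\<And>n. t \<le> n \<Longrightarrow> n \<le> \<tau> \<Longrightarrow> fps_nth (fps_of_poly q * S) n = 0) \<Longrightarrow> q = 0"
  shows "t < fps_space S t \<tau>"
proof -
  let ?M = "toeplitz (fps_nth S)"
  obtain A where A: "streaming_algorithm A" and comp: "computes_up_to A ?M \<tau>"
    and Max: "Max (bufsize A ` {..Suc t}) \<le> fps_space S t \<tau>"
    using stream_space_attained[of ?M \<tau> t] by (auto simp: fps_space_def toeplitz_def)
  let ?E = "Euclidean_space (Suc t)"
  have "inj_on (\<lambda>z. stream_state A z (Suc t)) (topspace ?E)"
  proof (rule inj_onI)
    fix z z'
    assume z: "z \<in> topspace ?E" "z' \<in> topspace ?E"
      and eq: "stream_state A z (Suc t) = stream_state A z' (Suc t)"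
    \<comment> \<open>The truncation loses nothing, as \<open>z\<close> and \<open>z'\<close> vanish
      after index \<open>t\<close>.\<close>
    define q where "q = truncate_fps (Suc t) (Abs_fps z - Abs_fps z')"
    have q: "fps_of_poly q = Abs_fps z - Abs_fps z'"
      using z by (auto simp: fps_eq_iff q_def coeff_truncate_fps topspace_Euclidean_space)
    have "q = 0"
    proof (rule window)
      show "degree q \<le> t"
        using degree_truncate_fps[of "Suc t"] by (simp add: q_def less_Suc_eq_le)
    next
      fix n assume n: "t \<le> n" "n \<le> \<tau>"
      have "stream_state A z (Suc n) = stream_state A z' (Suc n)"
        using z n by (intro stream_state_eq_later[OF eq]) (auto simp: topspace_Euclidean_space)
      then have "mat_apply ?M z n = mat_apply ?M z' n"
        using comp n(2) unfolding computes_up_to_def by metis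
      then show "fps_nth (fps_of_poly q * S) n = 0"
        by (simp add: mat_apply_toeplitz q left_diff_distrib)
    qed
    then show "z = z'"
      using q by (auto simp: fps_eq_iff)
  qed
  then have "Suc t \<le> bufsize A (Suc t)"
    using A continuous_inj_Euclidean_space_imp_le unfolding streaming_algorithm_def by blast
  also have "\<dots> \<le> Max (bufsize A ` {..Suc t})"
    by (rule Max_ge) auto
  finally show ?thesis
    using Max by linarith
qed

theorem theorem1p10:
  fixes l m :: real and t :: nat
  assumes "0 \<le> m" and "m < l" and "l \<le> 1"
  shows "int (fps_space (fps_sqrt (G_fps l m)) t (2 * t)) \<ge> int t - 4"
proof -
  define D where "D = [:1, -l:] * [:1, -m:]"
  have D: "fps_of_poly D = (1 - fps_const l * fps_X) * (1 - fps_const m * fps_X)"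
    by (simp only: D_def fps_of_poly_mult fps_of_poly_linear') (simp flip: fps_const_neg)
  have S: "fps_sqrt (G_fps l m) ^ 2 * fps_of_poly D = 1"
  proof -
    have "fps_sqrt (G_fps l m) ^ 2 = G_fps l m"
      using fps_sqrt_unique[OF G_fps_nth_0] by blast
    moreover have "fps_nth (fps_of_poly D) 0 \<noteq> 0"
      by (simp add: D_def)
    ultimately show ?thesis
      by (simp add: G_fps_def D fps_divide_unit inverse_mult_eq_1)
  qed
  have "degree D \<le> 2"
    unfolding D_def by (rule order_trans[OF degree_mult_le]) simp
  \<comment> \<open>The odd-order point is \<open>1 / l\<close>: here \<open>l > 0\<close>, and
    \<open>m \<noteq> l\<close> makes the root simple in \<open>D\<close>.\<close>
  have "Polynomial.order (1 / l) [:1, -l:] = 1"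
  proof -
    have "Polynomial.order (1 / l) [:1, -l:] \<le> 1"
      using order_degree[of "[:1, -l:]" "1 / l"] by (simp split: if_splits)
    moreover have "Polynomial.order (1 / l) [:1, -l:] \<noteq> 0"
      using order_root[of "[:1, -l:]" "1 / l"] assms by simp
    ultimately show ?thesis by simp
  qed
  moreover have "Polynomial.order (1 / l) [:1, -m:] = 0"
    using assms by (intro order_0I) (simp add: field_simps)
  moreover have "D \<noteq> 0"
    by (simp add: D_def)
  ultimately have "odd (Polynomial.order (1 / l) D)"
    unfolding D_def by (metis add.right_neutral odd_one order_mult)
  \<comment> \<open>The bound obtained is \<open>t + 1\<close>, stronger than
    \<open>t - 4\<close>.\<close>
  then have "t < fps_space (fps_sqrt (G_fps l m)) t (2 * t)"
    using fps_inverse_sqrt_window_eq_0[OF S \<open>degree D \<le> 2\<close>]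
    by (intro toeplitz_space_lower_bound) blast
  then show ?thesis
    by linarith
qed

end
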